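(* Let $f\in\mathbb{R}[x_1,\dots,x_n]$ be a polynomial of degree $d$, let $\mathbf{K}\subseteq\mathbb{R}^n$ be a compact set, and set $\widehat{f}_{\max}:=\max_{x\in\mathbf{K}}|f(x)|$. Then $$\underline{f}^{(rd)}_{\mathbf{K}} \;\le\; \mathbb{E}_{X\sim P_{f/t}}[f(X)] + \frac{\widehat{f}_{\max}}{2^r}\quad\text{for any integer } r\ge \frac{e\cdot \widehat{f}_{\max}}{t}\ \text{ and any } t>0,$$ where $e$ is the base of the natural logarithm.
   Context: For an integer $s\ge 0$, $\Sigma[x]_s$ denotes the set of polynomials in $\mathbb{R}[x_1,\dots,x_n]$ of degree at most $2s$ that are sums of squares of polynomials. The Lasserre measure-based upper bound of order $s$ on the minimum of $f$ over $\mathbf{K}$ is $$\underline{f}^{(s)}_{\mathbf{K}}:=\inf\Big\{\int_{\mathbf{K}}h(x)f(x)\,dx \;:\; h\in\Sigma[x]_s,\ \int_{\mathbf{K}}h(x)\,dx=1\Big\},$$ with integration with respect to Lebesgue measure. For a continuous function $g$, $P_g$ denotes the Boltzman distribution on $\mathbf{K}$ with density $P_g(x)=\exp(-g(x))/\int_{\mathbf{K}}\exp(-g(x'))\,dx'$, and $X\sim P_g$ means that the random variable $X$ takes values in $\mathbf{K}$ according to this distribution. Thus for $t>0$, $$\mathbb{E}_{X\sim P_{f/t}}[f(X)]=\frac{\int_{\mathbf{K}}f(x)e^{-f(x)/t}\,dx}{\int_{\mathbf{K}}e^{-f(x)/t}\,dx}.$$ *)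

theory Defs
  imports "HOL-Analysis.Analysis" "HOL-Library.Poly_Mapping"
begin

text \<open>
  A polynomial in the variables indexed by the finite type \<open>'n\<close> is a finitely supported map from
  exponent vectors to coefficients; the ring structure (convolution product) is the one of
  \<^theory>\<open>HOL-Library.Poly_Mapping\<close>.
\<close>
type_synonym 'n real_mpoly = "('n \<Rightarrow>\<^sub>0 nat) \<Rightarrow>\<^sub>0 real"

definition mpoly_eval :: "'n::finite real_mpoly \<Rightarrow> real ^ 'n \<Rightarrow> real" where
  "mpoly_eval p x = (\<Sum>m\<in>Poly_Mapping.keys p. Poly_Mapping.lookup p m * (\<Prod>i\<in>UNIV. (x $ i) ^ Poly_Mapping.lookup m i))"

text \<open>The total degree. The zero polynomial gets degree 0.\<close>
definition mpoly_degree :: "'n::finite real_mpoly \<Rightarrow> nat" where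
  "mpoly_degree p = Max (insert 0 ((\<lambda>m. \<Sum>i\<in>UNIV. Poly_Mapping.lookup m i) ` Poly_Mapping.keys p))"

definition sos_polys :: "nat \<Rightarrow> 'n::finite real_mpoly set" where
  "sos_polys s = {h. mpoly_degree h \<le> 2 * s \<and>
     (\<exists>(k::nat) (q :: nat \<Rightarrow> 'n real_mpoly). h = (\<Sum>j<k. q j ^ 2))}"

text \<open>The infimum is taken in the extended reals, so the infimum of the empty set is \<open>\<infinity>\<close>.\<close>
definition lasserre_upper_bound :: "(real ^ 'n::finite) set \<Rightarrow> 'n real_mpoly \<Rightarrow> nat \<Rightarrow> ereal" where
  "lasserre_upper_bound K f s =
     (INF h \<in> {h \<in> sos_polys s. (LINT x:K|lborel. mpoly_eval h x) = 1}.
        ereal (LINT x:K|lborel. mpoly_eval h x * mpoly_eval f x))"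

text \<open>
  This is a probability measure if, for instance, \<open>g\<close> is continuous and \<open>K\<close> is compact with
  positive Lebesgue measure. For a null set \<open>K\<close> the normalizing integral vanishes.
\<close>
definition boltzmann :: "(real ^ 'n::finite) set \<Rightarrow> (real ^ 'n \<Rightarrow> real) \<Rightarrow> (real ^ 'n) measure" where
  "boltzmann K g = density (restrict_space lborel K)
     (\<lambda>x. ennreal (exp (- g x) / (LINT y:K|lborel. exp (- g y))))"

text \<open>Equals the maximum of \<open>\<bar>f\<bar>\<close> over \<open>K\<close> for nonempty compact \<open>K\<close>, as it is then attained.\<close>
definition abs_max :: "(real ^ 'n::finite) set \<Rightarrow> 'n real_mpoly \<Rightarrow> real" where
  "abs_max K f = (SUP x\<in>K. \<bar>mpoly_eval f x\<bar>)"

end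

(*
  Take h proportional to the Taylor truncation S of exp(-f/t) at order 2r. With y = -f/t,
  S(y) is the integral of exp(-u) (y + u)^(2r) / (2r)! over u > 0; expanding (y + u)^r in the
  orthonormal Laguerre basis turns this into an explicit sum of r + 1 squares.
  Since |f|/t <= r/e on K, the Lagrange remainder together with n! >= (n/e)^n shows
  |S - exp(-f/t)| <= S / 2^(r+1) pointwise. If E is the Boltzmann mean, then exp(-f/t) (f - E)
  integrates to 0, so the integral of S (f - E) equals that of (S - exp(-f/t)) (f - E), which is
  at most 2 max|f| / 2^(r+1) times the integral of S.
*)
theory Submission
  imports Defs
begin

section \<open>Evaluation as a ring homomorphism\<close>

lemma mpoly_eval_superset:
  assumes "finite A" "Poly_Mapping.keys p \<subseteq> A"
  shows "mpoly_eval p x =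
    (\<Sum>m\<in>A. Poly_Mapping.lookup p m * (\<Prod>i\<in>UNIV. (x $ i) ^ Poly_Mapping.lookup m i))"
  unfolding mpoly_eval_def using assms
  by (intro sum.mono_neutral_left) (auto simp: in_keys_iff)

lemma mpoly_eval_zero [simp]: "mpoly_eval 0 x = 0"
  by (simp add: mpoly_eval_def)

lemma mpoly_eval_single:
  "mpoly_eval (Poly_Mapping.single m c) x = c * (\<Prod>i\<in>UNIV. (x $ i) ^ Poly_Mapping.lookup m i)"
  by (subst mpoly_eval_superset [of "{m}"]) auto

lemma mpoly_eval_const [simp]: "mpoly_eval (Poly_Mapping.single 0 c) x = c"
  by (simp add: mpoly_eval_single)

lemma mpoly_eval_one [simp]: "mpoly_eval 1 x = 1"
  using mpoly_eval_const [of 1 x] by simp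

lemma mpoly_eval_add [simp]: "mpoly_eval (p + q) x = mpoly_eval p x + mpoly_eval q x"
proof -
  \<comment> \<open>Cancellation can shrink the support of \<open>p + q\<close>, so all three
    evaluations are taken over one common index set.\<close>
  let ?A = "Poly_Mapping.keys p \<union> Poly_Mapping.keys q"
  have "Poly_Mapping.keys (p + q) \<subseteq> ?A"
    by (rule keys_add)
  then show ?thesis
    by (simp add: mpoly_eval_superset [of ?A] lookup_add distrib_right sum.distrib)
qed

lemma mpoly_eval_sum [simp]: "mpoly_eval (\<Sum>a\<in>A. p a) x = (\<Sum>a\<in>A. mpoly_eval (p a) x)"
  by (induction A rule: infinite_finite_induct) auto

lemma poly_mapping_sum_single:
  "p = (\<Sum>m\<in>Poly_Mapping.keys p. Poly_Mapping.single m (Poly_Mapping.lookup p m))"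
  by (rule poly_mapping_eqI)
     (simp add: lookup_sum lookup_single when_def sum.delta in_keys_iff)

text \<open>Both sides are bilinear in \<open>p\<close> and \<open>q\<close>, so decomposing each
  into monomials leaves the case of two monomials, where exponents add.\<close>

lemma mpoly_eval_mult [simp]: "mpoly_eval (p * q) x = mpoly_eval p x * mpoly_eval q x"
proof -
  let ?s = "\<lambda>p m. Poly_Mapping.single m (Poly_Mapping.lookup p m)"
  have single: "mpoly_eval (?s p m * ?s q n) x = mpoly_eval (?s p m) x * mpoly_eval (?s q n) x" for m n
    by (simp add: mult_single mpoly_eval_single lookup_add power_add prod.distrib)
  have "p * q = (\<Sum>m\<in>Poly_Mapping.keys p. \<Sum>n\<in>Poly_Mapping.keys q. ?s p m * ?s q n)"
    by (simp add: poly_mapping_sum_single [symmetric] flip: sum_product)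
  then have "mpoly_eval (p * q) x = (\<Sum>m\<in>Poly_Mapping.keys p. \<Sum>n\<in>Poly_Mapping.keys q.
      mpoly_eval (?s p m) x * mpoly_eval (?s q n) x)"
    by (simp add: single)
  also have "\<dots> = mpoly_eval (\<Sum>m\<in>Poly_Mapping.keys p. ?s p m) x *
      mpoly_eval (\<Sum>n\<in>Poly_Mapping.keys q. ?s q n) x"
    by (simp add: sum_product)
  finally show ?thesis
    by (simp add: poly_mapping_sum_single [symmetric])
qed

lemma mpoly_eval_power [simp]: "mpoly_eval (p ^ k) x = mpoly_eval p x ^ k"
  by (induction k) auto

lemma continuous_on_mpoly_eval: "continuous_on A (mpoly_eval p)"
  unfolding mpoly_eval_def [abs_def] by (intro continuous_intros)

section \<open>Bounds on the total degree\<close>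

lemma mpoly_degree_le_iff:
  "mpoly_degree p \<le> s \<longleftrightarrow> (\<forall>m\<in>Poly_Mapping.keys p. (\<Sum>i\<in>UNIV. Poly_Mapping.lookup m i) \<le> s)"
  by (simp add: mpoly_degree_def)

lemma mpoly_degree_single_zero [simp]: "mpoly_degree (Poly_Mapping.single 0 c) = 0"
  using mpoly_degree_le_iff [of "Poly_Mapping.single 0 c" 0] by (auto split: if_splits)

lemma mpoly_degree_add_le:
  assumes "mpoly_degree p \<le> s" "mpoly_degree q \<le> s"
  shows "mpoly_degree (p + q) \<le> s"
  using assms keys_add [of p q] by (auto simp: mpoly_degree_le_iff)

lemma mpoly_degree_sum_le:
  assumes "\<And>a. a \<in> A \<Longrightarrow> mpoly_degree (p a) \<le> s"
  shows "mpoly_degree (\<Sum>a\<in>A. p a) \<le> s"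
  using assms
  by (induction A rule: infinite_finite_induct)
     (auto simp: mpoly_degree_add_le mpoly_degree_le_iff [of 0])

lemma mpoly_degree_mult_le: "mpoly_degree (p * q) \<le> mpoly_degree p + mpoly_degree q"
proof (unfold mpoly_degree_le_iff, intro ballI)
  fix m assume "m \<in> Poly_Mapping.keys (p * q)"
  then obtain a b where m: "m = a + b" and "a \<in> Poly_Mapping.keys p" "b \<in> Poly_Mapping.keys q"
    using keys_mult [of p q] by auto
  then have "(\<Sum>i\<in>UNIV. Poly_Mapping.lookup a i) \<le> mpoly_degree p"
    "(\<Sum>i\<in>UNIV. Poly_Mapping.lookup b i) \<le> mpoly_degree q"
    using mpoly_degree_le_iff by blast+
  then show "(\<Sum>i\<in>UNIV. Poly_Mapping.lookup m i) \<le> mpoly_degree p + mpoly_degree q"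
    by (simp add: m lookup_add sum.distrib)
qed

lemma mpoly_degree_power_le: "mpoly_degree (p ^ k) \<le> k * mpoly_degree p"
proof (induction k)
  case 0
  show ?case
    using mpoly_degree_single_zero [of 1] by simp
next
  case (Suc k)
  then show ?case
    using mpoly_degree_mult_le [of p "p ^ k"] by simp
qed

section \<open>The even truncation of the exponential series as a sum of squares\<close>

lemma sum_choose_mult_choose:
  assumes "k \<le> r"
  shows "(\<Sum>j\<le>r. (k choose j) * (l choose j)) = (k + l) choose k"
proof -
  \<comment> \<open>Terms with j > k vanish; reflecting \<open>k choose j\<close> to
    \<open>k choose (k - j)\<close> turns the rest into a Vandermonde convolution.\<close>
  have "(\<Sum>j\<le>r. (k choose j) * (l choose j)) = (\<Sum>j\<le>k. (l choose j) * (k choose (k - j)))"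
    using assms by (intro sum.mono_neutral_cong_right) (auto simp: binomial_symmetric [symmetric])
  also have "\<dots> = (l + k) choose k"
    by (rule vandermonde)
  finally show ?thesis
    by (simp add: add.commute)
qed

text \<open>Up to sign, the inner sum over k is the coefficient of the j-th Laguerre polynomial in
  (y + u)^r, since that of u^k is (-1)^j k! (k choose j). No integral is used:
  \<open>sum_choose_mult_choose\<close>, multiplied by k! l!, gives (k + l)!, which is Parseval's
  identity for u^k and u^l under the weight exp(-u).\<close>

lemma truncated_exp_sum_of_squares:
  fixes y :: real
  shows "(\<Sum>k\<le>2 * r. y ^ k / fact k) =
    (\<Sum>j\<le>r. (\<Sum>k\<le>r. real ((r choose k) * fact k * (k choose j)) * y ^ (r - k))\<^sup>2) / fact (2 * r)"
proof -
  \<comment> \<open>The (k, l) term in the product of two expansions of (y + u)^r, with u^(k+l)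
    replaced by its moment (k + l)!.\<close>
  define F where "F = (\<lambda>k l. real ((r choose k) * (r choose l) * fact (k + l)) * y ^ (2 * r - (k + l)))"
  have F: "(\<Sum>j\<le>r. (real ((r choose k) * fact k * (k choose j)) * y ^ (r - k)) *
      (real ((r choose l) * fact l * (l choose j)) * y ^ (r - l))) = F k l"
    if kl: "k \<le> r" "l \<le> r" for k l
  proof -
    have "fact k * fact l * ((k + l) choose k) = (fact (k + l) :: nat)"
      using binomial_fact_lemma [of k "k + l"] by simp
    moreover have "(\<Sum>j\<le>r. (real ((r choose k) * fact k * (k choose j)) * y ^ (r - k)) *
      (real ((r choose l) * fact l * (l choose j)) * y ^ (r - l))) =
      real ((r choose k) * (r choose l) * (fact k * fact l * (\<Sum>j\<le>r. (k choose j) * (l choose j))))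
        * (y ^ (r - k) * y ^ (r - l))"
      by (simp add: sum_distrib_left sum_distrib_right mult_ac)
    moreover have "y ^ (r - k) * y ^ (r - l) = y ^ (2 * r - (k + l))"
      using kl by (simp add: mult_2 flip: power_add)
    ultimately show ?thesis
      by (simp only: F_def sum_choose_mult_choose [OF kl(1)])
  qed
  have "(\<Sum>j\<le>r. (\<Sum>k\<le>r. real ((r choose k) * fact k * (k choose j)) * y ^ (r - k))\<^sup>2) =
    (\<Sum>k\<le>r. \<Sum>l\<le>r. F k l)"
  proof -
    let ?a = "\<lambda>j k. real ((r choose k) * fact k * (k choose j)) * y ^ (r - k)"
    have "(\<Sum>j\<le>r. (\<Sum>k\<le>r. ?a j k)\<^sup>2) = (\<Sum>j\<le>r. \<Sum>k\<le>r. \<Sum>l\<le>r. ?a j k * ?a j l)"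
      by (simp only: power2_eq_square sum_product)
    also have "\<dots> = (\<Sum>k\<le>r. \<Sum>j\<le>r. \<Sum>l\<le>r. ?a j k * ?a j l)"
      by (rule sum.swap)
    also have "\<dots> = (\<Sum>k\<le>r. \<Sum>l\<le>r. \<Sum>j\<le>r. ?a j k * ?a j l)"
      by (intro sum.cong [OF refl] sum.swap)
    also have "\<dots> = (\<Sum>k\<le>r. \<Sum>l\<le>r. F k l)"
      by (intro sum.cong [OF refl] F) auto
    finally show ?thesis .
  qed
  also have "\<dots> = (\<Sum>(k,l)\<in>{..r} \<times> {..r}. F k l)"
    by (simp add: sum.cartesian_product)
  \<comment> \<open>The square of index pairs may be enlarged to a triangle: outside the square k >
    r or l > r, and a binomial factor of \<open>F\<close> is 0.\<close>
  also have "\<dots> = (\<Sum>(k,l)\<in>{(k,l). k + l \<le> 2 * r}. F k l)"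
  proof (rule sum.mono_neutral_left)
    show "finite {(k,l). k + l \<le> 2 * r}"
      by (rule finite_subset [of _ "{..2*r} \<times> {..2*r}"]) auto
  qed (auto simp: F_def)
  \<comment> \<open>Along the diagonal k + l = n only the product of the two binomials varies, so
    Vandermonde sums it to (2r choose n).\<close>
  also have "\<dots> = (\<Sum>n\<le>2 * r. \<Sum>k\<le>n. F k (n - k))"
    by (rule sum.triangle_reindex_eq)
  also have "\<dots> = (\<Sum>n\<le>2 * r. fact (2 * r) * (y ^ (2 * r - n) / fact (2 * r - n)))"
  proof (rule sum.cong [OF refl])
    fix n assume n: "n \<in> {..2 * r}"
    have "(\<Sum>k\<le>n. F k (n - k)) = real (\<Sum>k\<le>n. (r choose k) * (r choose (n - k))) * fact n * y ^ (2 * r - n)"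
      by (simp add: F_def sum_distrib_right)
    also have "\<dots> = real ((2 * r) choose n) * fact n * y ^ (2 * r - n)"
      by (simp only: vandermonde mult_2)
    finally show "(\<Sum>k\<le>n. F k (n - k)) = fact (2 * r) * (y ^ (2 * r - n) / fact (2 * r - n))"
      using n by (simp add: binomial_fact)
  qed
  also have "\<dots> = (\<Sum>n\<le>2 * r. fact (2 * r) * (y ^ n / fact n))"
    by (rule sum.reindex_bij_witness [of _ "\<lambda>n. 2 * r - n" "\<lambda>n. 2 * r - n"]) auto
  finally show ?thesis
    unfolding sum_distrib_left [symmetric] by simp
qed

section \<open>Relative error of the truncated exponential\<close>

lemma pow_div_fact_le_exp:
  fixes a :: real
  assumes "a \<ge> 0"
  shows "a ^ n / fact n \<le> exp a"
proof -
  have "a ^ n / fact n = (\<Sum>k\<in>{n}. a ^ k / fact k)"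
    by simp
  also have "\<dots> \<le> suminf (\<lambda>k. a ^ k / fact k)"
    using assms summable_exp [of a] by (intro sum_le_suminf) (auto simp: field_simps)
  finally show ?thesis
    by (simp add: exp_def divide_inverse mult.commute)
qed

text \<open>With n = 2r + 1, two bounds are multiplied. As e >= 2, a is at most r/2, so exp a <=
  sqrt(e)^r <= 2^r. As e a <= r <= n/2, a^n / n! <= (e a / n)^n <= 2^(-n). The product is
  2^(-(r+1)).\<close>

lemma exp_mult_pow_div_fact_le:
  fixes a :: real
  assumes "0 \<le> a" "exp 1 * a \<le> real r"
  shows "exp a * a ^ (2 * r + 1) / fact (2 * r + 1) \<le> 1 / 2 ^ (r + 1)"
proof -
  define n where "n = 2 * r + 1"
  have n: "real n > 0"
    by (simp add: n_def)
  have e2: "exp 1 \<ge> (2::real)"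
    using exp_ge_add_one_self [of 1] by simp
  have "exp (1 / 2 :: real) ^ 2 = exp 1"
    by (simp add: power2_eq_square flip: exp_add)
  moreover have "(2::real) ^ 2 = 4"
    by simp
  ultimately have "exp (1 / 2 :: real) ^ 2 \<le> 2 ^ 2"
    using exp_le by linarith
  then have e: "exp (1 / 2 :: real) \<le> 2"
    by (rule power2_le_imp_le) simp
  have "2 * a \<le> exp 1 * a"
    using e2 assms(1) by (rule mult_right_mono)
  then have "exp a \<le> exp (real r * (1 / 2))"
    using assms(2) by simp
  also have "\<dots> = exp (1 / 2) ^ r"
    by (simp only: exp_of_nat_mult)
  also have "\<dots> \<le> 2 ^ r"
    using e by (intro power_mono) auto
  finally have 1: "exp a \<le> 2 ^ r" .
  \<comment> \<open>The series bound at argument n and index n gives n! >= (n/e)^n.\<close>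
  have "real n ^ n / fact n \<le> exp 1 ^ n"
    using pow_div_fact_le_exp [of "real n" n] by (simp flip: exp_of_nat_mult)
  then have "(a / n) ^ n * (real n ^ n / fact n) \<le> (a / n) ^ n * exp 1 ^ n"
    using assms(1) by (intro mult_left_mono) auto
  then have "a ^ n / fact n \<le> (a * exp 1 / n) ^ n"
    using n by (simp add: power_divide power_mult_distrib)
  also have "\<dots> \<le> (1 / 2) ^ n"
    using n assms by (intro power_mono) (auto simp: n_def field_simps)
  finally have 2: "a ^ n / fact n \<le> (1 / 2) ^ n" .
  have "exp a * (a ^ n / fact n) \<le> 2 ^ r * (1 / 2) ^ n"
    using 1 2 assms(1) by (intro mult_mono) auto
  also have "(1 / 2 :: real) ^ n = (1 / 2) ^ r * (1 / 2) ^ (r + 1)"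
    unfolding n_def power_add [symmetric] by (rule arg_cong) simp
  also have "2 ^ r * \<dots> = (1 / 2) ^ (r + 1)"
    unfolding mult.assoc [symmetric] power_mult_distrib [symmetric] by simp
  also have "\<dots> = 1 / 2 ^ (r + 1)"
    by (rule power_one_over)
  finally show ?thesis
    by (simp only: n_def times_divide_eq_right)
qed

text \<open>The error is measured relative to \<open>S\<close>, the weight that is later integrated.
  For x >= 0 an absolute bound suffices because S >= 1. For x < 0 the first omitted power is odd, so
  the remainder is negative and S >= exp x; it then suffices to bound the error relative to exp
  x.\<close>

lemma truncated_exp_error:
  fixes x :: real
  assumes x: "exp 1 * \<bar>x\<bar> \<le> real r"
  defines "S \<equiv> \<Sum>k\<le>2 * r. x ^ k / fact k"
  shows "S > 0" "\<bar>S - exp x\<bar> \<le> S / 2 ^ (r + 1)"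
proof -
  define n where "n = 2 * r + 1"
  have S: "S = (\<Sum>k<n. x ^ k / fact k)"
    by (simp add: S_def n_def lessThan_Suc_atMost)
  have B: "exp \<bar>x\<bar> * \<bar>x\<bar> ^ n / fact n \<le> 1 / 2 ^ (r + 1)"
    unfolding n_def using x by (intro exp_mult_pow_div_fact_le) auto
  have "S > 0 \<and> \<bar>S - exp x\<bar> \<le> S / 2 ^ (r + 1)"
  proof (cases "x \<ge> 0")
    case True
    obtain s where s: "\<bar>s\<bar> \<le> \<bar>x\<bar>" "exp x = S + exp s / fact n * x ^ n"
      using Maclaurin_exp_le [of x n] S by auto
    have "(\<Sum>k\<in>{0}. x ^ k / fact k) \<le> S"
      unfolding S_def using True by (intro sum_mono2) auto
    then have S1: "S \<ge> 1"
      by simp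
    have "\<bar>S - exp x\<bar> = exp s * \<bar>x\<bar> ^ n / fact n"
      using True by (simp add: s(2) abs_mult)
    also have "\<dots> \<le> exp \<bar>x\<bar> * \<bar>x\<bar> ^ n / fact n"
      using s(1) by (intro divide_right_mono mult_right_mono) auto
    also note B
    also have "1 / 2 ^ (r + 1) \<le> S / 2 ^ (r + 1)"
      using S1 by (intro divide_right_mono) auto
    finally show ?thesis
      using S1 by simp
  next
    case False
    \<comment> \<open>This form of the remainder locates s in (x, 0), which gives exp s < 1.\<close>
    have "\<exists>s. x < s \<and> s < 0 \<and> exp x = (\<Sum>k<n. exp 0 / fact k * x ^ k) + exp s / fact n * x ^ n"
      using False by (intro Maclaurin_minus) (auto simp: n_def)
    then obtain s where s: "s < 0" "exp x = S + exp s / fact n * x ^ n"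
      by (auto simp: S)
    have xn: "x ^ n = - (\<bar>x\<bar> ^ n)"
      using False by (simp add: n_def power_minus_odd)
    have "S \<ge> exp x"
      by (simp add: s(2) xn)
    moreover have "\<bar>S - exp x\<bar> \<le> exp x / 2 ^ (r + 1)"
    proof -
      have "\<bar>S - exp x\<bar> = exp s * \<bar>x\<bar> ^ n / fact n"
        by (simp add: s(2) xn abs_mult)
      also have "\<dots> \<le> 1 * \<bar>x\<bar> ^ n / fact n"
        using s(1) by (intro divide_right_mono mult_right_mono) auto
      \<comment> \<open>Inserting 1 = exp x * exp |x| makes the error relative; this is why
        \<open>B\<close> carries the factor exp |x|.\<close>
      also have "\<dots> = exp x * (exp \<bar>x\<bar> * \<bar>x\<bar> ^ n / fact n)"
        using False by (simp add: exp_minus field_simps)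
      also have "\<dots> \<le> exp x * (1 / 2 ^ (r + 1))"
        using B by (intro mult_left_mono) auto
      finally show ?thesis
        by simp
    qed
    moreover have "exp x / 2 ^ (r + 1) \<le> S / 2 ^ (r + 1)"
      using \<open>S \<ge> exp x\<close> by (intro divide_right_mono) auto
    ultimately show ?thesis
      using exp_gt_zero [of x] by linarith
  qed
  then show "S > 0" "\<bar>S - exp x\<bar> \<le> S / 2 ^ (r + 1)"
    by auto
qed

section \<open>Weighted means over a compact set\<close>

lemma set_integrable_compact:
  fixes g :: "'a::euclidean_space \<Rightarrow> real"
  assumes "compact K" "continuous_on K g"
  shows "set_integrable lborel K g"
  using borel_integrable_compact [OF assms] by (simp add: set_integrable_def)

text \<open>By compactness the integrand attains a positive minimum, and the integral is at least
  this minimum times the measure of \<open>K\<close>, which is finite and positive.\<close>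

lemma set_integral_compact_pos:
  fixes g :: "'a::euclidean_space \<Rightarrow> real"
  assumes K: "compact K" "emeasure lborel K > 0"
    and g: "continuous_on K g" "\<And>x. x \<in> K \<Longrightarrow> g x > 0"
  shows "(LINT x:K|lborel. g x) > 0"
proof -
  have "K \<noteq> {}"
    using K(2) by auto
  then obtain z where z: "z \<in> K" "\<And>x. x \<in> K \<Longrightarrow> g z \<le> g x"
    using continuous_attains_inf [OF K(1) _ g(1)] by auto
  have fin: "emeasure lborel K < \<infinity>"
    using K(1) by (rule emeasure_compact_finite)
  have "0 < measure lborel K"
    using K(2) fin by (simp add: measure_def enn2real_positive_iff)
  then have "0 < g z * measure lborel K"
    using g(2) z(1) by simp
  also have "\<dots> = (LINT x:K|lborel. g z)"
    using K(1) fin by (simp add: set_integral_const borel_compact)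
  also have "\<dots> \<le> (LINT x:K|lborel. g x)"
    using K(1) g(1) z(2) by (intro set_integral_mono set_integrable_compact continuous_intros) auto
  finally show ?thesis .
qed

text \<open>To be applied with the Boltzmann weight as \<open>u\<close> and its Taylor truncation as
  \<open>v\<close>, both unnormalized. Since the error is relative to \<open>v\<close>, the integral
  of \<open>v\<close> appears in the final estimate and cancels on division.\<close>

lemma weighted_mean_perturbation:
  fixes g u v :: "'a::euclidean_space \<Rightarrow> real"
  assumes K: "compact K" "emeasure lborel K > 0"
    and cont [continuous_intros]: "continuous_on K g" "continuous_on K u" "continuous_on K v"
    and pos: "\<And>x. x \<in> K \<Longrightarrow> u x > 0" "\<And>x. x \<in> K \<Longrightarrow> v x > 0"
    and close: "\<And>x. x \<in> K \<Longrightarrow> \<bar>v x - u x\<bar> \<le> \<epsilon> * v x"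
    and bound: "\<And>x. x \<in> K \<Longrightarrow> \<bar>g x\<bar> \<le> M"
  shows "(LINT x:K|lborel. v x * g x) / (LINT x:K|lborel. v x) \<le>
    (LINT x:K|lborel. u x * g x) / (LINT x:K|lborel. u x) + 2 * \<epsilon> * M"
proof -
  define U where "U = (LINT x:K|lborel. u x)"
  define V where "V = (LINT x:K|lborel. v x)"
  define E where "E = (LINT x:K|lborel. u x * g x) / U"
  have U: "U > 0" and V: "V > 0"
    unfolding U_def V_def using assms by (auto intro!: set_integral_compact_pos)
  note int = set_integrable_compact [OF K(1)]
  \<comment> \<open>As a weighted mean of values in [-M, M], \<open>E\<close> lies in that interval;
    this half gives the upper end.\<close>
  have "(LINT x:K|lborel. u x * g x) \<le> (LINT x:K|lborel. u x * M)"
    using bound pos(1)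
    by (intro set_integral_mono int continuous_intros mult_left_mono) (fastforce simp: abs_le_iff)+
  then have E_le: "E \<le> M"
    using U by (simp add: E_def U_def [symmetric] field_simps)
  have "(LINT x:K|lborel. u x * - M) \<le> (LINT x:K|lborel. u x * g x)"
    using bound pos(1)
    by (intro set_integral_mono int continuous_intros mult_left_mono) (fastforce simp: abs_le_iff)+
  then have E_ge: "- M \<le> E"
    using U unfolding set_integral_mult_left by (simp add: E_def U_def [symmetric] field_simps)
  \<comment> \<open>The subtracted bracket is 0 by the choice of \<open>E\<close>; it brings in the
    difference of the weights.\<close>
  have "(LINT x:K|lborel. v x * g x) - E * V =
      (LINT x:K|lborel. v x * g x) - E * V - ((LINT x:K|lborel. u x * g x) - E * U)"
    using U by (simp add: E_def)
  also have "\<dots> = (LINT x:K|lborel. (v x * g x - E * v x) - (u x * g x - E * u x))"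
    unfolding U_def V_def
    by (simp add: set_integral_diff int continuous_intros)
  also have "\<dots> \<le> (LINT x:K|lborel. 2 * \<epsilon> * M * v x)"
  proof (intro set_integral_mono int continuous_intros)
    fix x assume x: "x \<in> K"
    have "(v x * g x - E * v x) - (u x * g x - E * u x) = (v x - u x) * (g x - E)"
      by (simp add: algebra_simps)
    also have "\<dots> \<le> \<bar>v x - u x\<bar> * \<bar>g x - E\<bar>"
      by (metis abs_ge_self abs_mult)
    \<comment> \<open>Both \<open>g x\<close> and \<open>E\<close> lie in [-M, M], hence the factor
      2 M.\<close>
    also have "\<dots> \<le> (\<epsilon> * v x) * (2 * M)"
      using close [OF x] bound [OF x] E_le E_ge by (intro mult_mono) auto
    finally show "(v x * g x - E * v x) - (u x * g x - E * u x) \<le> 2 * \<epsilon> * M * v x"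
      by (simp add: mult_ac)
  qed
  also have "\<dots> = 2 * \<epsilon> * M * V"
    by (simp add: V_def)
  finally show ?thesis
    using V unfolding V_def [symmetric] U_def [symmetric] E_def [symmetric]
    by (simp add: field_simps)
qed

section \<open>Boltzmann means and feasible points of the Lasserre problem\<close>

lemma integral_boltzmann:
  assumes "compact K" "continuous_on UNIV g" "continuous_on UNIV h"
  shows "integral\<^sup>L (boltzmann K g) h =
    (LINT x:K|lborel. exp (- g x) * h x) / (LINT x:K|lborel. exp (- g x))"
proof -
  let ?Z = "LINT x:K|lborel. exp (- g x)"
  have [measurable]: "g \<in> borel_measurable borel" "h \<in> borel_measurable borel"
    using assms by (auto intro: borel_measurable_continuous_onI)
  \<comment> \<open>Nonnegativity keeps \<open>ennreal\<close> from truncating the density. If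
    \<open>?Z\<close> is 0, both sides of the claim are 0 because division by zero yields 0.\<close>
  have Z: "?Z \<ge> 0"
    unfolding set_lebesgue_integral_def by (intro integral_nonneg_AE) auto
  have [measurable]: "(\<lambda>x. exp (- g x) / ?Z) \<in> borel_measurable (restrict_space lborel K)"
    "h \<in> borel_measurable (restrict_space lborel K)"
    by (intro measurable_restrict_space1; measurable)+
  have "integral\<^sup>L (boltzmann K g) h =
      (LINT x|restrict_space lborel K. (exp (- g x) / ?Z) *\<^sub>R h x)"
    unfolding boltzmann_def using Z by (intro integral_density) auto
  also have "\<dots> = (LINT x:K|lborel. exp (- g x) * h x / ?Z)"
    using assms(1) by (subst integral_restrict_space) (auto simp: set_lebesgue_integral_def borel_compact)
  finally show ?thesis
    by simp
qed

lemma lasserre_upper_bound_le: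
  assumes "h \<in> sos_polys s" "(LINT x:K|lborel. mpoly_eval h x) = 1"
  shows "lasserre_upper_bound K f s \<le> ereal (LINT x:K|lborel. mpoly_eval h x * mpoly_eval f x)"
  unfolding lasserre_upper_bound_def by (rule INF_lower) (use assms in blast)

text \<open>The square identity is applied at y = c f, and the nonnegative factor a / (2r)! is
  absorbed into the squares through its root \<open>b\<close>. Each squared polynomial involves f
  only up to the power r, hence the degree bound.\<close>

lemma truncated_exp_mpoly:
  fixes f :: "'n::finite real_mpoly"
  assumes "a \<ge> 0"
  obtains h where "h \<in> sos_polys (r * mpoly_degree f)"
    "\<And>x. mpoly_eval h x = a * (\<Sum>k\<le>2 * r. (c * mpoly_eval f x) ^ k / fact k)"
proof -
  let ?C = "Poly_Mapping.single 0 :: real \<Rightarrow> 'n real_mpoly"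
  define b where "b = sqrt (a / fact (2 * r))"
  have b: "b\<^sup>2 = a / fact (2 * r)"
    using assms by (simp add: b_def)
  define q where "q = (\<lambda>j. \<Sum>k\<le>r. ?C (b * real ((r choose k) * fact k * (k choose j)) * c ^ (r - k)) * f ^ (r - k))"
  have q: "mpoly_degree (q j) \<le> r * mpoly_degree f" for j
    unfolding q_def
  proof (rule mpoly_degree_sum_le)
    fix k
    let ?e = "b * real ((r choose k) * fact k * (k choose j)) * c ^ (r - k)"
    have "mpoly_degree (?C ?e * f ^ (r - k)) \<le> (r - k) * mpoly_degree f"
      using mpoly_degree_mult_le [of "?C ?e" "f ^ (r - k)"] mpoly_degree_power_le [of f "r - k"] by simp
    also have "\<dots> \<le> r * mpoly_degree f"
      by (intro mult_right_mono) auto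
    finally show "mpoly_degree (?C ?e * f ^ (r - k)) \<le> r * mpoly_degree f" .
  qed
  \<comment> \<open>\<open>sos_polys\<close> indexes squares by j < k, so the r + 1 squares with j
    <= r appear as j < \<open>Suc r\<close>.\<close>
  have degree: "mpoly_degree (\<Sum>j<Suc r. q j ^ 2) \<le> 2 * (r * mpoly_degree f)"
  proof (rule mpoly_degree_sum_le)
    fix j
    show "mpoly_degree (q j ^ 2) \<le> 2 * (r * mpoly_degree f)"
      using mpoly_degree_power_le [of "q j" 2] q [of j] by simp
  qed
  have "(\<Sum>j<Suc r. q j ^ 2) \<in> sos_polys (r * mpoly_degree f)"
    unfolding sos_polys_def using degree by blast
  moreover have "mpoly_eval (\<Sum>j<Suc r. q j ^ 2) x = a * (\<Sum>k\<le>2 * r. (c * mpoly_eval f x) ^ k / fact k)" for x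
  proof -
    let ?s = "\<lambda>j. \<Sum>k\<le>r. real ((r choose k) * fact k * (k choose j)) * (c * mpoly_eval f x) ^ (r - k)"
    have "mpoly_eval (q j) x = b * ?s j" for j
      by (simp add: q_def sum_distrib_left power_mult_distrib mult_ac)
    then have "mpoly_eval (\<Sum>j<Suc r. q j ^ 2) x = (\<Sum>j\<le>r. b\<^sup>2 * (?s j)\<^sup>2)"
      by (simp only: mpoly_eval_sum mpoly_eval_power power_mult_distrib lessThan_Suc_atMost)
    also have "\<dots> = a * ((\<Sum>j\<le>r. (?s j)\<^sup>2) / fact (2 * r))"
      unfolding sum_distrib_left [symmetric] b by simp
    finally show ?thesis
      by (simp only: truncated_exp_sum_of_squares)
  qed
  ultimately show thesis
    using that by blast
qed

theorem theorem4p1: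
  fixes f :: "'n::finite real_mpoly" and K :: "(real ^ 'n) set"
    and d r :: nat and t :: real
  assumes "mpoly_degree f = d"
    and "compact K"
    and "emeasure lborel K > 0"
    and "t > 0"
    and "real r \<ge> exp 1 * abs_max K f / t"
  shows "lasserre_upper_bound K f (r * d)
    \<le> ereal (integral\<^sup>L (boltzmann K (\<lambda>x. mpoly_eval f x / t)) (mpoly_eval f) + abs_max K f / 2 ^ r)"
proof -
  define g where "g = mpoly_eval f"
  define M where "M = abs_max K f"
  define u where "u = (\<lambda>x. exp (- (g x / t)))"
  define v where "v = (\<lambda>x. \<Sum>k\<le>2 * r. (- 1 / t * g x) ^ k / fact k)"
  define V where "V = (LINT x:K|lborel. v x)"
  have g: "continuous_on A g" for A
    unfolding g_def by (rule continuous_on_mpoly_eval)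
  have u: "continuous_on K u" and v: "continuous_on K v"
    unfolding u_def v_def by (intro continuous_intros g; use \<open>t > 0\<close> in simp)+
  \<comment> \<open>A real supremum bounds its set only when the set is bounded above; compactness
    of \<open>K\<close> supplies this.\<close>
  have "bdd_above ((\<lambda>x. \<bar>g x\<bar>) ` K)"
    by (intro bounded_imp_bdd_above compact_imp_bounded compact_continuous_image
        continuous_intros g assms(2))
  then have bound: "\<bar>g x\<bar> \<le> M" if "x \<in> K" for x
    unfolding M_def abs_max_def g_def using that by (intro cSUP_upper) auto
  have small: "exp 1 * \<bar>- 1 / t * g x\<bar> \<le> real r" if "x \<in> K" for x
  proof -
    have "exp 1 * \<bar>- 1 / t * g x\<bar> = exp 1 * \<bar>g x\<bar> / t"
      using \<open>t > 0\<close> by (simp add: abs_mult)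
    also have "\<dots> \<le> exp 1 * M / t"
      using bound [OF that] \<open>t > 0\<close> by (intro divide_right_mono mult_left_mono) auto
    finally show ?thesis
      using assms(5) by (simp add: M_def)
  qed
  have v_pos: "v x > 0" and v_close: "\<bar>v x - u x\<bar> \<le> 1 / 2 ^ (r + 1) * v x" if "x \<in> K" for x
    using truncated_exp_error [OF small [OF that]] by (simp_all add: v_def u_def)
  have V: "V > 0"
    unfolding V_def using assms(2,3) v v_pos by (rule set_integral_compact_pos)
  \<comment> \<open>The scaling by \<open>inverse V\<close> makes \<open>h\<close> integrate to 1
    over \<open>K\<close>.\<close>
  obtain h where h: "h \<in> sos_polys (r * d)"
    and h_eval: "\<And>x. mpoly_eval h x = inverse V * v x"
    using truncated_exp_mpoly [of "inverse V" r f "- 1 / t"] V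
    unfolding assms(1) v_def g_def by auto
  have "lasserre_upper_bound K f (r * d) \<le> ereal (LINT x:K|lborel. mpoly_eval h x * g x)"
    unfolding g_def using h V by (intro lasserre_upper_bound_le) (simp_all add: h_eval flip: V_def)
  also have "(LINT x:K|lborel. mpoly_eval h x * g x) = (LINT x:K|lborel. v x * g x) / V"
    unfolding h_eval mult.assoc by (simp add: divide_inverse mult.commute)
  \<comment> \<open>Here the relative error is 1 / 2^(r+1), and doubling it gives the claimed 1 /
    2^r.\<close>
  also have "\<dots> \<le> (LINT x:K|lborel. u x * g x) / (LINT x:K|lborel. u x) + 2 * (1 / 2 ^ (r + 1)) * M"
    unfolding V_def using assms(2,3) g u v v_pos v_close bound
    by (intro weighted_mean_perturbation) (auto simp: u_def)
  also have "(LINT x:K|lborel. u x * g x) / (LINT x:K|lborel. u x) =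
      integral\<^sup>L (boltzmann K (\<lambda>x. g x / t)) g"
    unfolding u_def using assms(2,4) g
    by (subst integral_boltzmann) (auto intro!: continuous_intros)
  finally show ?thesis
    by (simp add: g_def M_def)
qed

end
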